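(* Let $\mathbf{s}=(s_1,s_2,\dots)$ be a sequence of positive integers. For any positive integer $n$ and any positive real numbers $p$ and $q$, the polynomial in $x$ $$E_n^{(\mathbf{s})}(x,p,q)=\sum_{\mathbf{e}\in\mathfrak{I}_n^{(\mathbf{s})}}x^{\operatorname{asc}\mathbf{e}}q^{\operatorname{amaj}\mathbf{e}}p^{|\mathbf{e}|}$$ has only real roots.
   Context: For a sequence $\mathbf{s}$ of positive integers, $\mathfrak{I}_n^{(\mathbf{s})}=\{(e_1,\dots,e_n)\in\mathbb{Z}^n\mid0\le e_i<s_i\text{ for }1\le i\le n\}$. For $\mathbf{e}\in\mathfrak{I}_n^{(\mathbf{s})}$: $\operatorname{Asc}\mathbf{e}=\{i\in\{0,1,\dots,n-1\}\mid e_i/s_i<e_{i+1}/s_{i+1}\}$ with the convention $e_0=0$, $s_0=1$; $\operatorname{asc}\mathbf{e}=|\operatorname{Asc}\mathbf{e}|$; $\operatorname{amaj}\mathbf{e}=\sum_{j\in\operatorname{Asc}\mathbf{e}}(n-j)$; and $|\mathbf{e}|=e_1+\cdots+e_n$. A polynomial "has only real roots" if all its complex roots are real. *)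

theory Defs
  imports
    Complex_Main
    "HOL-Library.FuncSet"
    "HOL-Computational_Algebra.Polynomial"
begin

text \<open>
  A sequence \<open>s\<close> is indexed from 1: the value \<open>s 0\<close> is never used.  An inversion sequence of
  length \<open>n\<close> is an extensional function on \<open>{1..n}\<close>, so that distinct functions
  are distinct tuples and the set of inversion sequences is finite.
\<close>

definition inv_seqs :: "(nat \<Rightarrow> nat) \<Rightarrow> nat \<Rightarrow> (nat \<Rightarrow> nat) set" where
  "inv_seqs s n = (\<Pi>\<^sub>E i\<in>{1..n}. {0..<s i})"

text \<open>The updates at 0 implement the convention \<open>e 0 = 0\<close>, \<open>s 0 = 1\<close>.\<close>

definition ratio :: "(nat \<Rightarrow> nat) \<Rightarrow> (nat \<Rightarrow> nat) \<Rightarrow> nat \<Rightarrow> real" where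
  "ratio s e i = real ((e(0 := 0)) i) / real ((s(0 := 1)) i)"

definition Asc :: "(nat \<Rightarrow> nat) \<Rightarrow> nat \<Rightarrow> (nat \<Rightarrow> nat) \<Rightarrow> nat set" where
  "Asc s n e = {i \<in> {0..<n}. ratio s e i < ratio s e (i + 1)}"

definition asc :: "(nat \<Rightarrow> nat) \<Rightarrow> nat \<Rightarrow> (nat \<Rightarrow> nat) \<Rightarrow> nat" where
  "asc s n e = card (Asc s n e)"

definition amaj :: "(nat \<Rightarrow> nat) \<Rightarrow> nat \<Rightarrow> (nat \<Rightarrow> nat) \<Rightarrow> nat" where
  "amaj s n e = (\<Sum>j\<in>Asc s n e. n - j)"

definition weight :: "nat \<Rightarrow> (nat \<Rightarrow> nat) \<Rightarrow> nat" where
  "weight n e = (\<Sum>i=1..n. e i)"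

definition E_poly :: "(nat \<Rightarrow> nat) \<Rightarrow> nat \<Rightarrow> real \<Rightarrow> real \<Rightarrow> real poly" where
  "E_poly s n p q = (\<Sum>e\<in>inv_seqs s n. monom (q ^ amaj s n e * p ^ weight n e) (asc s n e))"

definition only_real_roots :: "real poly \<Rightarrow> bool" where
  "only_real_roots P \<longleftrightarrow> (\<forall>z::complex. poly (map_poly complex_of_real P) z = 0 \<longrightarrow> z \<in> \<real>)"

end

theory Submission
  imports Defs
begin

text \<open>
  Fix \<open>z\<close> in the open upper half plane and let \<open>v k\<close> be the value at \<open>z\<close> of the part of the
  polynomial coming from the inversion sequences with last entry \<open>k\<close>. The vectors
  \<open>v 0, \<dots>, v (m - 1), z * v 0\<close> are nonzero and occur in counterclockwise order, spanning an angle
  less than \<open>\<pi>\<close>. This property passes from length \<open>n\<close> to length \<open>n + 1\<close>: every new vector is a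
  positive multiple of a sum in which an initial segment of the old vectors, growing with \<open>k\<close>, is
  multiplied by \<open>z\<close>, and the substitution of \<open>q z\<close> for \<open>z\<close> does not change arguments. Hence the
  sum of all the \<open>v k\<close> is nonzero, so there is no root in the upper half plane and, by
  conjugation, none in the lower one.
\<close>

section \<open>Orientation of vectors in the complex plane\<close>

definition cross :: "complex \<Rightarrow> complex \<Rightarrow> real" where
  "cross a b = Im (cnj a * b)"

text \<open>\<open>cross a b\<close> is |a| |b| times the sine of the angle from \<open>a\<close> to
  \<open>b\<close>. For Im z > 0 the two inequalities place the direction of \<open>v k\<close> in
  the closed sector from \<open>v l\<close> to \<open>z * v l\<close>. All pairs are demanded
  because nonnegativity of \<open>cross\<close> is not transitive.\<close>

definition ccw_ordered :: "complex \<Rightarrow> nat \<Rightarrow> (nat \<Rightarrow> complex) \<Rightarrow> bool" where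
  "ccw_ordered z m v \<longleftrightarrow> (\<forall>l<m. v l \<noteq> 0) \<and>
     (\<forall>k<m. \<forall>l\<le>k. 0 \<le> cross (v l) (v k) \<and> 0 \<le> cross (v k) (z * v l))"

lemma cross_sum: "cross (sum f A) (sum g B) = (\<Sum>a\<in>A. \<Sum>b\<in>B. cross (f a) (g b))"
  by (simp add: cross_def cnj_sum sum_product Im_sum del: complex_cnj_mult)

lemma cross_sum_left: "cross (sum f A) b = (\<Sum>a\<in>A. cross (f a) b)"
  using cross_sum[of f A "\<lambda>_. b" "{()}"] by simp

lemma cross_sum_nonneg:
  "(\<And>a b. a \<in> A \<Longrightarrow> b \<in> B \<Longrightarrow> 0 \<le> cross (f a) (g b)) \<Longrightarrow> 0 \<le> cross (sum f A) (sum g B)"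
  by (simp add: cross_sum sum_nonneg)

lemma cross_self_mult: "cross a (z * a) = Im z * (cmod a)\<^sup>2"
  unfolding cross_def cmod_power2 by (simp add: algebra_simps power2_eq_square)

lemma cross_scale:
  "cross (of_real c * a) (of_real d * b) = c * d * cross a b"
  by (simp add: cross_def algebra_simps)

text \<open>\<open>A\<close>, \<open>B\<close>, \<open>C\<close> stand for sums over three
  consecutive index blocks; \<open>B\<close> is the block that acquires the factor \<open>z\<close>.
  The terms pairing \<open>z * A\<close> with \<open>C\<close> cancel, and the rest are nonnegative
  for ordered blocks.\<close>

lemma cross_block_1:
  "cross (z * A + B + C) (z * A + z * B + C) =
    (cmod z)\<^sup>2 * cross A B + cross B (z * A) + Im z * (cmod B)\<^sup>2 + cross B C + cross C (z * B)"
  unfolding cross_def cmod_power2 by (simp add: algebra_simps power2_eq_square)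

lemma cross_block_2:
  "cross (z * A + z * B + C) (z * (z * A + B + C)) =
    Im z * (cmod (z * A + C))\<^sup>2 +
    (cmod z)\<^sup>2 * (cross A B + cross B (z * A) + cross B C) + cross C (z * B)"
  unfolding cross_def cmod_power2 by (simp add: algebra_simps power2_eq_square)

text \<open>With \<open>a\<close> the least index, no \<open>v l\<close> has negative
  \<open>cross\<close> with \<open>z * v a\<close>, and \<open>v a\<close> has a positive one, so
  the sum cannot vanish.\<close>

lemma ccw_ordered_sum_nonzero:
  assumes v: "ccw_ordered z m v" and z: "Im z > 0" and I: "I \<subseteq> {..<m}" "I \<noteq> {}"
  shows "sum v I \<noteq> 0"
proof -
  have fin: "finite I" using I finite_subset by blast
  define a where "a = Min I"
  have a: "a \<in> I" "\<And>l. l \<in> I \<Longrightarrow> a \<le> l" using fin I by (auto simp: a_def)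
  have "0 < (\<Sum>l\<in>I. cross (v l) (z * v a))"
  proof (rule sum_pos2[OF fin a(1)])
    show "0 < cross (v a) (z * v a)"
      using v z a I by (auto simp: cross_self_mult ccw_ordered_def)
    show "0 \<le> cross (v l) (z * v a)" if "l \<in> I" for l
      using v a(2)[OF that] that I by (auto simp: ccw_ordered_def)
  qed
  then have "cross (sum v I) (z * v a) \<noteq> 0" by (simp add: cross_sum_left)
  then show ?thesis by (metis cross_def complex_cnj_zero mult_zero_left zero_complex.sel(2))
qed

lemma ccw_ordered_step:
  fixes P :: "nat \<Rightarrow> nat \<Rightarrow> bool"
  assumes v: "ccw_ordered z m v" and z: "Im z > 0" and m: "m > 0"
    and down: "\<And>i l l'. P i l \<Longrightarrow> l' \<le> l \<Longrightarrow> P i l'"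
    and up: "\<And>i j l. P i l \<Longrightarrow> i \<le> j \<Longrightarrow> P j l"
  shows "ccw_ordered z m' (\<lambda>i. \<Sum>l<m. (if P i l then z else 1) * v l)"
proof -
  let ?w = "\<lambda>i. \<Sum>l<m. (if P i l then z else 1) * v l"
  \<comment> \<open>By bilinearity the pairwise inequalities pass to sums over separated index
    sets.\<close>
  have ord: "0 \<le> cross (sum v X) (sum v Y)" "0 \<le> cross (sum v Y) (z * sum v X)"
    if "X \<subseteq> {..<m}" "Y \<subseteq> {..<m}" "\<And>x y. x \<in> X \<Longrightarrow> y \<in> Y \<Longrightarrow> x < y" for X Y
  proof -
    have *: "0 \<le> cross (v x) (v y)" "0 \<le> cross (v y) (z * v x)" if "x \<in> X" "y \<in> Y" for x y
      using v that \<open>X \<subseteq> _\<close> \<open>Y \<subseteq> _\<close> \<open>\<And>x y. x \<in> X \<Longrightarrow> y \<in> Y \<Longrightarrow> x < y\<close>[OF that]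
      unfolding ccw_ordered_def by (meson less_imp_le lessThan_iff subsetD)+
    show "0 \<le> cross (sum v X) (sum v Y)" by (rule cross_sum_nonneg) (rule *)
    show "0 \<le> cross (sum v Y) (z * sum v X)"
      unfolding sum_distrib_left by (rule cross_sum_nonneg) (rule *)
  qed
  have main: "?w i \<noteq> 0 \<and> 0 \<le> cross (?w i) (?w j) \<and> 0 \<le> cross (?w j) (z * ?w i)"
    if "i \<le> j" for i j
  proof -
    \<comment> \<open>The blocks carry the factor \<open>z\<close> in both sums, only in
      \<open>?w j\<close>, and in neither. Monotonicity of \<open>P\<close> makes them consecutive
      segments.\<close>
    define A where "A = {l \<in> {..<m}. P i l}"
    define B where "B = {l \<in> {..<m}. \<not> P i l \<and> P j l}"
    define C where "C = {l \<in> {..<m}. \<not> P j l}"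
    have fin: "finite A" "finite B" "finite C" by (auto simp: A_def B_def C_def)
    have sub: "A \<subseteq> {..<m}" "B \<subseteq> {..<m}" "C \<subseteq> {..<m}" "B \<union> C \<subseteq> {..<m}"
      by (auto simp: A_def B_def C_def)
    have split: "sum f {..<m} = sum f A + sum f B + sum f C" for f :: "nat \<Rightarrow> complex"
    proof -
      have "{..<m} = A \<union> B \<union> C" "A \<inter> B = {}" "(A \<union> B) \<inter> C = {}"
        using up[OF _ \<open>i \<le> j\<close>] by (auto simp: A_def B_def C_def)
      then show ?thesis using fin by (simp add: sum.union_disjoint)
    qed
    have wi: "?w i = z * sum v A + sum v B + sum v C"
      unfolding split sum_distrib_left using up[OF _ \<open>i \<le> j\<close>]
      by (intro arg_cong2[of _ _ _ _ "(+)"] sum.cong) (auto simp: A_def B_def C_def)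
    have wj: "?w j = z * sum v A + z * sum v B + sum v C"
      unfolding split sum_distrib_left using up[OF _ \<open>i \<le> j\<close>]
      by (intro arg_cong2[of _ _ _ _ "(+)"] sum.cong) (auto simp: A_def B_def C_def)
    have lt: "l < l'" if "P k l" "\<not> P k l'" for k l l'
      using down[of k l l'] that not_less by blast
    have AB: "x < y" if "x \<in> A" "y \<in> B" for x y
      using that lt by (auto simp: A_def B_def)
    have AC: "x < y" if "x \<in> A" "y \<in> C" for x y
      using that lt up[OF _ \<open>i \<le> j\<close>] by (auto simp: A_def C_def)
    have BC: "x < y" if "x \<in> B" "y \<in> C" for x y
      using that lt by (auto simp: B_def C_def)
    note ineqs = ord[OF sub(1,2) AB] ord[OF sub(1,3) AC] ord[OF sub(2,3) BC]
    have "0 \<le> cross (?w i) (?w j)"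
      unfolding wi wj cross_block_1 using ineqs z by simp
    moreover have "0 \<le> cross (?w j) (z * ?w i)"
      unfolding wi wj cross_block_2 using ineqs z by simp
    moreover have "?w i \<noteq> 0"
    proof
      \<comment> \<open>Then the sum over the later blocks is -z times the sum over
        \<open>A\<close>, which puts it clockwise of the latter unless both vanish; two vanishing
        sums force empty blocks, against \<open>m > 0\<close>.\<close>
      assume "?w i = 0"
      have BC_eq: "sum v (B \<union> C) = sum v B + sum v C"
        using fin by (intro sum.union_disjoint) (auto simp: B_def C_def)
      have BC_val: "sum v (B \<union> C) = - (z * sum v A)"
        using \<open>?w i = 0\<close> unfolding wi BC_eq by (simp add: eq_neg_iff_add_eq_0 algebra_simps)
      have "0 \<le> cross (sum v A) (sum v (B \<union> C))"
        using AB AC by (intro ord sub) auto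
      then have "Im z * (cmod (sum v A))\<^sup>2 \<le> 0"
        unfolding BC_val cross_self_mult[symmetric] by (simp add: cross_def)
      then have A0: "sum v A = 0" using z by (simp add: mult_le_0_iff)
      then have "sum v (B \<union> C) = 0" using BC_val by simp
      then have "A = {}" "B \<union> C = {}"
        using A0 ccw_ordered_sum_nonzero[OF v z] sub by blast+
      moreover have "{..<m} \<subseteq> A \<union> (B \<union> C)" by (auto simp: A_def B_def C_def)
      ultimately show False using m by auto
    qed
    ultimately show ?thesis by blast
  qed
  then show ?thesis unfolding ccw_ordered_def by blast
qed

text \<open>The two kinds of \<open>cross\<close> change by the positive factors
  \<open>c k * c l\<close> and \<open>c k * c l / q\<close>, so their signs survive.\<close>

lemma ccw_ordered_scale:
  assumes "ccw_ordered (of_real q * z) m w" "q > 0" "\<And>k. c k > 0"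
  shows "ccw_ordered z m (\<lambda>k. of_real (c k) * w k)"
proof -
  have "cross (of_real (c k) * w k) (z * (of_real (c l) * w l)) =
      c k * c l / q * cross (w k) (of_real q * z * w l)" for k l
    using \<open>q > 0\<close> by (simp add: cross_def field_simps)
  moreover have "c k \<noteq> 0" for k using assms(3)[of k] by simp
  ultimately show ?thesis
    using assms less_imp_le[OF assms(3)] unfolding ccw_ordered_def by (simp add: cross_scale)
qed

section \<open>Recursion over the last entry of an inversion sequence\<close>

context
  fixes s :: "nat \<Rightarrow> nat" and p q :: real
begin

definition inv_term :: "nat \<Rightarrow> (nat \<Rightarrow> nat) \<Rightarrow> complex \<Rightarrow> complex" where
  "inv_term n e z = of_real (q ^ amaj s n e * p ^ weight n e) * z ^ asc s n e"

text \<open>At length 0 the convention for position 0 leaves one admissible last entry, 0,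
  contributed by the empty sequence with value 1.\<close>

primrec last_part :: "nat \<Rightarrow> nat \<Rightarrow> complex \<Rightarrow> complex" where
  "last_part 0 k z = 1"
| "last_part (Suc n) k z = of_real (p ^ k) *
     (\<Sum>l<(s(0 := 1)) n. (if real l / real ((s(0 := 1)) n) < real k / real (s (Suc n))
        then of_real q * z else 1) * last_part n l (of_real q * z))"

lemma poly_E_poly: "poly (map_poly complex_of_real (E_poly s n p q)) z = (\<Sum>e\<in>inv_seqs s n. inv_term n e z)"
proof -
  have "map_poly complex_of_real (E_poly s n p q) =
      (\<Sum>e\<in>inv_seqs s n. monom (of_real (q ^ amaj s n e * p ^ weight n e)) (asc s n e))"
    unfolding E_poly_def
    by (rule poly_eqI) (simp add: coeff_map_poly coeff_sum of_real_sum if_distrib cong: if_cong)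
  then show ?thesis by (simp add: poly_sum poly_monom inv_term_def)
qed

text \<open>Lengthening raises the \<open>amaj\<close> weight of each old ascent by one; the
  resulting \<open>q ^ asc s n e\<close> is absorbed by evaluating at \<open>q z\<close>. A new
  ascent at \<open>n\<close> has weight 1 and contributes \<open>q z\<close>.\<close>

lemma inv_term_extend:
  "inv_term (Suc n) (e(Suc n := k)) z =
    (if ratio s e n < real k / real (s (Suc n)) then of_real q * z else 1) * of_real (p ^ k) *
    inv_term n e (of_real q * z)"
proof -
  let ?e = "e(Suc n := k)"
  have ratio_eq: "ratio s ?e i = ratio s e i" if "i \<le> n" for i
    using that by (simp add: ratio_def)
  have ratio_last: "ratio s ?e (Suc n) = real k / real (s (Suc n))"
    by (simp add: ratio_def)
  have Asc_eq: "Asc s (Suc n) ?e =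
      (if ratio s e n < real k / real (s (Suc n)) then insert n (Asc s n e) else Asc s n e)"
    by (auto simp: Asc_def ratio_eq ratio_last less_Suc_eq)
  have fin: "finite (Asc s n e)" and notin: "n \<notin> Asc s n e" by (auto simp: Asc_def)
  have shift: "(\<Sum>j\<in>Asc s n e. Suc n - j) = amaj s n e + asc s n e"
  proof -
    \<comment> \<open>Truncated subtraction is harmless here, as ascents satisfy
      \<open>j < n\<close>.\<close>
    have "(\<Sum>j\<in>Asc s n e. Suc n - j) = (\<Sum>j\<in>Asc s n e. (n - j) + 1)"
      by (rule sum.cong) (auto simp: Asc_def)
    then show ?thesis by (simp only: sum.distrib) (simp add: amaj_def asc_def)
  qed
  have asc_eq: "asc s (Suc n) ?e = asc s n e + (if ratio s e n < real k / real (s (Suc n)) then 1 else 0)"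
    using fin notin by (simp add: asc_def Asc_eq)
  have amaj_eq: "amaj s (Suc n) ?e = amaj s n e + asc s n e +
      (if ratio s e n < real k / real (s (Suc n)) then 1 else 0)"
    using fin notin shift by (simp add: amaj_def[of s "Suc n"] Asc_eq)
  have weight_eq: "weight (Suc n) ?e = weight n e + k"
    by (simp add: weight_def)
  show ?thesis
    unfolding inv_term_def asc_eq amaj_eq weight_eq
    by (simp add: power_add power_mult_distrib)
qed

lemma sum_inv_seqs_Suc:
  "(\<Sum>e\<in>inv_seqs s (Suc n). h e) = (\<Sum>k<s (Suc n). \<Sum>e\<in>inv_seqs s n. h (e(Suc n := k)))"
  for h :: "_ \<Rightarrow> complex"
proof -
  have "inv_seqs s (Suc n) = (\<lambda>(k, e). e(Suc n := k)) ` ({..<s (Suc n)} \<times> inv_seqs s n)"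
    unfolding inv_seqs_def
    by (simp add: atLeastAtMostSuc_conv PiE_insert_eq atLeast0LessThan)
  moreover have "inj_on (\<lambda>(k, e). e(Suc n := k)) ({..<s (Suc n)} \<times> inv_seqs s n)"
    unfolding inv_seqs_def using inj_combinator[of "Suc n" "{1..n}" "\<lambda>i. {0..<s i}"]
    by (simp add: atLeast0LessThan)
  ultimately show ?thesis
    by (simp add: sum.reindex sum.cartesian_product split_def)
qed

text \<open>The test function \<open>f\<close> of the last entry lets the sum be split by that entry, which is what
  the comparison at the next position depends on.\<close>

lemma sum_inv_term_last:
  "(\<Sum>e\<in>inv_seqs s n. f ((e(0 := 0)) n) * inv_term n e z) =
    (\<Sum>k<(s(0 := 1)) n. f k * last_part n k z)"
proof (induction n arbitrary: f z)
  case 0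
  show ?case by (simp add: inv_seqs_def inv_term_def asc_def amaj_def Asc_def weight_def)
next
  case (Suc n)
  let ?c = "\<lambda>k l. if real l / real ((s(0 := 1)) n) < real k / real (s (Suc n))
    then of_real q * z else 1"
  have "(\<Sum>e\<in>inv_seqs s n. f k * inv_term (Suc n) (e(Suc n := k)) z) = f k * last_part (Suc n) k z" for k
  proof -
    have "(\<Sum>e\<in>inv_seqs s n. f k * inv_term (Suc n) (e(Suc n := k)) z) =
        (\<Sum>e\<in>inv_seqs s n. f k * of_real (p ^ k) * ?c k ((e(0 := 0)) n) * inv_term n e (of_real q * z))"
      unfolding inv_term_extend by (simp only: ratio_def mult_ac)
    \<comment> \<open>The induction hypothesis is used at \<open>q z\<close>, with the ascent factor
      absorbed into the test function.\<close>
    also have "\<dots> = (\<Sum>l<(s(0 := 1)) n. f k * of_real (p ^ k) * ?c k l * last_part n l (of_real q * z))"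
      by (rule Suc.IH)
    also have "\<dots> = f k * last_part (Suc n) k z"
      by (simp only: last_part.simps sum_distrib_left mult_ac)
    finally show ?thesis .
  qed
  then show ?case by (simp add: sum_inv_seqs_Suc del: last_part.simps)
qed

section \<open>Absence of roots in the open upper half plane\<close>

lemma ccw_ordered_last_part:
  assumes s: "\<And>i. i \<ge> 1 \<Longrightarrow> s i > 0" and "p > 0" "q > 0" "Im z > 0"
  shows "ccw_ordered z ((s(0 := 1)) n) (\<lambda>k. last_part n k z)"
  using \<open>Im z > 0\<close>
proof (induction n arbitrary: z)
  case 0
  then show ?case by (simp add: ccw_ordered_def cross_def)
next
  case (Suc n)
  have Im: "Im (of_real q * z) > 0" using Suc.prems \<open>q > 0\<close> by simp
  have pos: "(s(0 := 1)) n > 0" using s[of n] by simp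
  show ?case
    unfolding last_part.simps
  \<comment> \<open>The ascent condition serves as \<open>P\<close>: it persists when
    \<open>l\<close> decreases or \<open>k\<close> increases. The order obtained at
    \<open>q z\<close> is carried back to \<open>z\<close> with the factors
    \<open>p ^ k\<close>.\<close>
  proof (rule ccw_ordered_scale[OF ccw_ordered_step[OF Suc.IH[OF Im] Im pos] \<open>q > 0\<close>])
    show "real l' / real ((s(0 := 1)) n) < real i / real (s (Suc n))"
      if "real l / real ((s(0 := 1)) n) < real i / real (s (Suc n))" "l' \<le> l" for i l l'
      using that(1) divide_right_mono[of "real l'" "real l" "real ((s(0 := 1)) n)"] that(2)
      by linarith
    show "real l / real ((s(0 := 1)) n) < real j / real (s (Suc n))"
      if "real l / real ((s(0 := 1)) n) < real i / real (s (Suc n))" "i \<le> j" for i j l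
      using that(1) divide_right_mono[of "real i" "real j" "real (s (Suc n))"] that(2)
      by linarith
    show "0 < p ^ k" for k using \<open>p > 0\<close> by simp
  qed
qed

lemma E_poly_nonzero_upper:
  assumes s: "\<And>i. i \<ge> 1 \<Longrightarrow> s i > 0" and "p > 0" "q > 0" "Im z > 0"
  shows "poly (map_poly complex_of_real (E_poly s n p q)) z \<noteq> 0"
proof -
  have "(s(0 := 1)) n > 0" using s[of n] by simp
  then have "(\<Sum>k<(s(0 := 1)) n. last_part n k z) \<noteq> 0"
    using ccw_ordered_sum_nonzero[OF ccw_ordered_last_part[OF assms] \<open>Im z > 0\<close>] by blast
  \<comment> \<open>The constant test function 1 sums over all last entries.\<close>
  then show ?thesis
    using sum_inv_term_last[of "\<lambda>_. 1" n z] by (simp add: poly_E_poly)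
qed

lemma poly_E_poly_cnj:
  "poly (map_poly complex_of_real (E_poly s n p q)) (cnj z) =
    cnj (poly (map_poly complex_of_real (E_poly s n p q)) z)"
  by (simp add: poly_E_poly inv_term_def)

end

theorem theorem5p2:
  fixes s :: "nat \<Rightarrow> nat" and n :: nat and p q :: real
  assumes "\<And>i. i \<ge> 1 \<Longrightarrow> s i > 0"
    and "n > 0"
    and "p > 0"
    and "q > 0"
  shows "only_real_roots (E_poly s n p q)"
  unfolding only_real_roots_def
proof (intro allI impI)
  fix z assume root: "poly (map_poly complex_of_real (E_poly s n p q)) z = 0"
  note nz = E_poly_nonzero_upper[of s p q, OF assms(1,3,4)]
  have "\<not> Im z > 0" using nz root by blast
  moreover have "\<not> Im (cnj z) > 0" using nz root by (metis poly_E_poly_cnj complex_cnj_zero)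
  ultimately have "Im z = 0" by simp
  then show "z \<in> \<real>" by (simp add: complex_is_Real_iff)
qed

end
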